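(* Let $\mathbb{F}$ be a field, let $(\mathcal{V}, \langle \cdot , \cdot \rangle)$ be a pre-euclidean space over $\mathbb{F}$, let $f:\mathcal{V}\to\mathcal{V}$ be a linear operator, and let $\mathcal{B}$ and $\mathcal{B}'$ be two bases of $\mathcal{V}$. If $\mathcal{B}$ and $\mathcal{B}'$ are $f$-equivalent, then the associated graphs $\Gamma(f,\mathcal{B})$ and $\Gamma(f,\mathcal{B}')$ are isomorphic.
   Context: Vector spaces are over an arbitrary field $\mathbb{F}$ and of arbitrary (possibly infinite) dimension. A pre-euclidean space is a pair $(\mathcal{V}, \langle\cdot,\cdot\rangle)$ where $\mathcal{V}$ is an $\mathbb{F}$-vector space and $\langle\cdot,\cdot\rangle:\mathcal{V}\times\mathcal{V}\to\mathbb{F}$ is a bilinear form (no symmetry or non-degeneracy is assumed). An automorphism of $\mathcal{V}$ is a bijective linear map $\phi:\mathcal{V}\to\mathcal{V}$ with $\langle\phi(x),\phi(y)\rangle=\langle x,y\rangle$ for all $x,y\in\mathcal{V}$. Associated graph: for a basis $\mathcal{B}=\{e_i\}_{i\in I}$, $\Gamma(f,\mathcal{B})=(V,E)$ is the directed graph with vertex set $V=\mathcal{B}$ and with $(e_i,e_j)\in E$ if and only if $\langle e_i,e_j\rangle\neq 0$, or $\langle e_j,e_i\rangle\neq 0$, or the coefficient of $e_j$ in the expansion of $f(e_i)$ in the basis $\mathcal{B}$ is non-zero. Two bases $\mathcal{B},\mathcal{B}'$ of $\mathcal{V}$ are $f$-equivalent if there is an automorphism $\phi$ of $\mathcal{V}$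 with $\phi(\mathcal{B})=\mathcal{B}'$ and $\phi\circ f=f\circ\phi$. Graphs $(V,E)$ and $(V',E')$ are isomorphic if there is a bijection $\psi:V\to V'$ such that $(v,w)\in E$ if and only if $(\psi(v),\psi(w))\in E'$. *)

theory Defs
  imports "Graph_Theory.Digraph_Isomorphism" "Graph_Theory.Pair_Digraph"
begin

definition (in vector_space) is_basis :: "'b set \<Rightarrow> bool" where
  "is_basis B \<longleftrightarrow> independent B \<and> span B = UNIV"

locale pre_euclidean_space = vector_space scale
  for scale :: "'a::field \<Rightarrow> 'v::ab_group_add \<Rightarrow> 'v" (infixr \<open>*s\<close> 75) +
  fixes form :: "'v \<Rightarrow> 'v \<Rightarrow> 'a"
  assumes linear_form_left: "Vector_Spaces.linear scale (*) (\<lambda>x. form x y)"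
    and linear_form_right: "Vector_Spaces.linear scale (*) (\<lambda>y. form x y)"
begin

definition automorphism :: "('v \<Rightarrow> 'v) \<Rightarrow> bool" where
  "automorphism \<phi> \<longleftrightarrow>
    bij \<phi> \<and> Vector_Spaces.linear scale scale \<phi> \<and> (\<forall>x y. form (\<phi> x) (\<phi> y) = form x y)"

definition f_equivalent :: "('v \<Rightarrow> 'v) \<Rightarrow> 'v set \<Rightarrow> 'v set \<Rightarrow> bool" where
  "f_equivalent f B B' \<longleftrightarrow> (\<exists>\<phi>. automorphism \<phi> \<and> \<phi> ` B = B' \<and> \<phi> \<circ> f = f \<circ> \<phi>)"

definition assoc_graph :: "('v \<Rightarrow> 'v) \<Rightarrow> 'v set \<Rightarrow> 'v pair_pre_digraph" where
  "assoc_graph f B =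
    \<lparr> pverts = B,
      parcs = {(e, e'). e \<in> B \<and> e' \<in> B \<and>
        (form e e' \<noteq> 0 \<or> form e' e \<noteq> 0 \<or> representation B (f e) e' \<noteq> 0)} \<rparr>"

lemma pair_wf_digraph_assoc_graph: "pair_wf_digraph (assoc_graph f B)"
  by unfold_locales (auto simp: assoc_graph_def)

end

text \<open>The library's \<^const>\<open>digraph_iso\<close> is stated for multigraphs and also maps arcs. On
  graphs \<open>(V, E)\<close> with \<open>E \<subseteq> V \<times> V\<close> it is the existence of a bijection of the
  vertices that preserves and reflects edges.\<close>

lemma digraph_iso_with_proj_iff:
  assumes G: "pair_wf_digraph G" and H: "pair_wf_digraph H"
  shows "digraph_iso (with_proj G) (with_proj H) \<longleftrightarrow>
    (\<exists>\<psi>. bij_betw \<psi> (pverts G) (pverts H) \<and>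
      (\<forall>v\<in>pverts G. \<forall>w\<in>pverts G. (v, w) \<in> parcs G \<longleftrightarrow> (\<psi> v, \<psi> w) \<in> parcs H))"
    (is "?L \<longleftrightarrow> ?R")
proof
  assume ?L
  then obtain h where iso: "pre_digraph.digraph_isomorphism (with_proj G) h"
    and eq: "with_proj H = app_iso h (with_proj G)"
    unfolding digraph_iso_def by blast
  have V: "pverts H = iso_verts h ` pverts G" and E: "parcs H = iso_arcs h ` parcs G"
    and t: "iso_tail h = fst" and hd: "iso_head h = snd"
    using eq by (auto simp: with_proj_def app_iso_def)
  have inj: "inj_on (iso_verts h) (pverts G)"
    using iso by (simp add: pre_digraph.digraph_isomorphism_def)
  have arc: "iso_arcs h a = (iso_verts h (fst a), iso_verts h (snd a))" if "a \<in> parcs G" for a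
    using iso that t hd
    by (auto simp: pre_digraph.digraph_isomorphism_def prod_eq_iff)
  have wf: "fst a \<in> pverts G \<and> snd a \<in> pverts G" if "a \<in> parcs G" for a
    using G that pair_wf_digraph.arc_fst_in_verts[of G] pair_wf_digraph.arc_snd_in_verts[of G]
    by blast
  have "(v, w) \<in> parcs G \<longleftrightarrow> (iso_verts h v, iso_verts h w) \<in> parcs H"
    if "v \<in> pverts G" "w \<in> pverts G" for v w
  proof
    assume "(v, w) \<in> parcs G"
    then show "(iso_verts h v, iso_verts h w) \<in> parcs H" using arc[of "(v, w)"] E by (metis fst_conv snd_conv imageI)
  next
    assume "(iso_verts h v, iso_verts h w) \<in> parcs H"
    then obtain a where a: "a \<in> parcs G" "iso_arcs h a = (iso_verts h v, iso_verts h w)"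
      using E by (metis imageE)
    then have "fst a = v" "snd a = w"
      using arc[OF a(1)] wf[OF a(1)] that inj_onD[OF inj] by simp_all
    then show "(v, w) \<in> parcs G" using a(1) by (cases a) simp
  qed
  then show ?R using V inj by (auto simp: bij_betw_def)
next
  assume ?R
  then obtain \<psi> where b: "bij_betw \<psi> (pverts G) (pverts H)"
    and e: "\<And>v w. v \<in> pverts G \<Longrightarrow> w \<in> pverts G \<Longrightarrow>
      (v, w) \<in> parcs G \<longleftrightarrow> (\<psi> v, \<psi> w) \<in> parcs H" by blast
  have wfG: "fst a \<in> pverts G \<and> snd a \<in> pverts G" if "a \<in> parcs G" for a
    using G that pair_wf_digraph.arc_fst_in_verts[of G] pair_wf_digraph.arc_snd_in_verts[of G]
    by blast
  have wfH: "fst a \<in> pverts H \<and> snd a \<in> pverts H" if "a \<in> parcs H" for a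
    using H that pair_wf_digraph.arc_fst_in_verts[of H] pair_wf_digraph.arc_snd_in_verts[of H]
    by blast
  have inj: "inj_on \<psi> (pverts G)" and im: "\<psi> ` pverts G = pverts H"
    using b by (auto simp: bij_betw_def)
  have E: "map_prod \<psi> \<psi> ` parcs G = parcs H"
  proof (intro equalityI subsetI)
    fix a assume "a \<in> map_prod \<psi> \<psi> ` parcs G"
    then obtain v w where "(v, w) \<in> parcs G" "a = (\<psi> v, \<psi> w)" by auto
    then show "a \<in> parcs H" using e[of v w] wfG[of "(v, w)"] by simp
  next
    fix a assume a: "a \<in> parcs H"
    obtain v w where vw: "v \<in> pverts G" "w \<in> pverts G" "fst a = \<psi> v" "snd a = \<psi> w"
      using wfH[OF a] im by (metis imageE)
    then have "(v, w) \<in> parcs G" using e a by (cases a) simp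
    then show "a \<in> map_prod \<psi> \<psi> ` parcs G" using vw by (intro image_eqI[of _ _ "(v, w)"]) (simp_all add: prod_eq_iff)
  qed
  define h where "h = \<lparr> iso_verts = \<psi>, iso_arcs = map_prod \<psi> \<psi>, iso_head = snd, iso_tail = fst \<rparr>"
  have injE: "inj_on (map_prod \<psi> \<psi>) (parcs G)"
    by (rule inj_onI) (use wfG inj_onD[OF inj] in \<open>simp add: prod_eq_iff\<close>)
  have "wf_digraph (with_proj G)"
    using wfG by (auto simp: wf_digraph_def)
  then have "pre_digraph.digraph_isomorphism (with_proj G) h"
    using inj injE by (simp add: pre_digraph.digraph_isomorphism_def h_def)
  moreover have "with_proj H = app_iso h (with_proj G)"
    using im E by (simp add: with_proj_def app_iso_def h_def)
  ultimately show ?L unfolding digraph_iso_def by blast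
qed

end

theory Submission
  imports Defs
begin

lemma (in Vector_Spaces.linear) representation_image_inj:
  assumes inj: "inj f" and indep: "vs1.independent B" and v: "v \<in> vs1.span B"
  shows "vs2.representation (f ` B) (f v) (f b) = vs1.representation B v b"
proof -
  let ?r = "vs2.representation (f ` B) (f v)"
  interpret pair: vector_space_pair s1 s2 ..
  have lin: "Vector_Spaces.linear s1 s2 f" ..
  have indep': "vs2.independent (f ` B)"
    using pair.linear_independent_injective_image[OF lin indep] inj by (simp add: inj_on_subset)
  have v': "f v \<in> vs2.span (f ` B)"
    using v by (simp add: span_image)
  have supp: "{b'. ?r b' \<noteq> 0} = f ` {b. ?r (f b) \<noteq> 0}"
    using vs2.representation_ne_zero[of "f ` B" "f v"] by fastforce
  \<comment> \<open>Coordinates are unique, so it suffices that the coordinates of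
    \<open>f v\<close>, pulled back along \<open>f\<close>, are supported in \<open>B\<close>,
    finitely many, and sum up to \<open>v\<close>.\<close>
  have "vs1.representation B v = (\<lambda>b. ?r (f b))"
  proof (rule vs1.representation_eqI[OF indep v])
    show "b \<in> B" if "?r (f b) \<noteq> 0" for b
      using vs2.representation_ne_zero[OF that] inj by (simp add: inj_image_mem_iff)
    show "finite {b. ?r (f b) \<noteq> 0}"
      using finite_vimageI[OF vs2.finite_representation inj] by (simp add: vimage_def)
    \<comment> \<open>The expansion is checked after applying \<open>f\<close>, where reindexing
      along \<open>supp\<close> gives the known expansion of \<open>f v\<close>; injectivity then
      cancels \<open>f\<close>.\<close>
    have "f (\<Sum>b | ?r (f b) \<noteq> 0. s1 (?r (f b)) b) = (\<Sum>b | ?r (f b) \<noteq> 0. s2 (?r (f b)) (f b))"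
      by (simp add: sum scale)
    also have "\<dots> = (\<Sum>b' | ?r b' \<noteq> 0. s2 (?r b') b')"
      unfolding supp using inj by (subst sum.reindex) (auto intro: inj_on_subset)
    also have "\<dots> = f v"
      by (rule vs2.sum_nonzero_representation_eq[OF indep' v'])
    finally show "(\<Sum>b | ?r (f b) \<noteq> 0. s1 (?r (f b)) b) = v"
      using inj by (simp add: inj_eq)
  qed
  then show ?thesis by simp
qed

theorem lemma4p1:
  fixes scale :: "'a::field \<Rightarrow> 'v::ab_group_add \<Rightarrow> 'v"
    and form :: "'v \<Rightarrow> 'v \<Rightarrow> 'a"
    and f :: "'v \<Rightarrow> 'v"
    and B B' :: "'v set"
  assumes "pre_euclidean_space scale form"
    and "Vector_Spaces.linear scale scale f"
    and "vector_space.is_basis scale B"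
    and "vector_space.is_basis scale B'"
    and "pre_euclidean_space.f_equivalent scale form f B B'"
  shows "digraph_iso
    (with_proj (pre_euclidean_space.assoc_graph scale form f B))
    (with_proj (pre_euclidean_space.assoc_graph scale form f B'))"
proof -
  interpret pre_euclidean_space scale form by fact
  obtain \<phi> where "automorphism \<phi>" and B': "B' = \<phi> ` B" and comm: "\<And>x. \<phi> (f x) = f (\<phi> x)"
    using assms(5) by (auto simp: f_equivalent_def fun_eq_iff)
  then have inj: "inj \<phi>" and lin: "Vector_Spaces.linear scale scale \<phi>"
    and form: "\<And>x y. form (\<phi> x) (\<phi> y) = form x y"
    by (auto simp: automorphism_def bij_def)
  \<comment> \<open>Commutation makes f (\<phi> x) the image under \<phi> of \<open>f x\<close>,
    which lies in the span of \<open>B\<close> because \<open>B\<close> is a basis.\<close>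
  have rep: "representation B' (f (\<phi> x)) (\<phi> y) = representation B (f x) y" for x y
    using linear.representation_image_inj[OF lin inj, of B "f x" y] assms(3)
    by (simp add: B' comm is_basis_def)
  have "bij_betw \<phi> B B'"
    using inj by (auto simp: B' bij_betw_def intro: inj_on_subset)
  moreover have "(x, y) \<in> parcs (assoc_graph f B) \<longleftrightarrow> (\<phi> x, \<phi> y) \<in> parcs (assoc_graph f B')"
    if "x \<in> B" "y \<in> B" for x y
    using that by (simp add: assoc_graph_def form rep) (simp add: B')
  ultimately show ?thesis
    unfolding digraph_iso_with_proj_iff[OF pair_wf_digraph_assoc_graph pair_wf_digraph_assoc_graph]
    by (auto simp: assoc_graph_def)
qed

end
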